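(* Let $\mathcal{A}=\langle Q,q_0,X,T,\mathrm{Acc}\rangle$ be a timed automaton and let $G$ be an adaptive simulation graph (ASG) for $\mathcal{A}$ with designated initial node $(q_0,Z_0,L_0U_0)$. Then $\mathcal{A}$ has an accepting run (a run ending in a configuration $(q,v)$ with $q\in\mathrm{Acc}$) if and only if some node of $G$ labelled $(q,Z,LU)$ with $q\in \mathrm{Acc}$ and $Z\neq\emptyset$ is reachable from the initial node of $G$.
   Context: Timed automata. $X$ is a finite set of clocks. A clock constraint (guard) is a conjunction of atomic constraints $x\,\#\,c$ with $x\in X$, $\#\in\{<,\le,=,\ge,>\}$, $c\in\mathbb{N}$ (no diagonal constraints). A valuation is a map $v:X\to\mathbb{R}_{\ge0}$; $v+\delta$ adds $\delta$ to every clock; $[R]v$ sets the clocks in $R\subseteq X$ to $0$ and leaves the others unchanged; $\mathbf{0}$ is the all-zero valuation. A timed automaton $\langle Q,q_0,X,T,\mathrm{Acc}\rangle$ has finite state set $Q$, initial state $q_0$, accepting states $\mathrm{Acc}\subseteq Q$ and transitions $t=(q,g,R,q')\in T$ with $g$ a guard and $R\subseteq X$. Configurations are pairs $(q,v)$; the initial one is $(q_0,\mathbf 0)$. Moves: delay $(q,v)\to^{\delta}(q,v+\delta)$ for $\delta\in\mathbb{R}_{\ge 0}$, and action $(q,v)\to^{t}(q',[R]v)$ for $t=(q,g,R,q')$ with $v\models g$. A run is a finite sequence of moves from $(q_0,\mathbf 0)$. Symbolic transitions. For a set of valuations $W$ and a transition $t$ from $q$ to $q'$, $\mathrm{Post}_t(W)=\{v'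 : \exists v\in W,\ \exists \delta\ge 0,\ (q,v)\to^{t}\to^{\delta}(q',v')\}$, and we write $(q,W)\Rightarrow_t(q',\mathrm{Post}_t(W))$. The transition $t$ is disabled from $(q,W)$ if $\mathrm{Post}_t(W)=\emptyset$. A zone is a set of valuations defined by a conjunction of constraints $x\sim c$ and $x-y\sim c$ with $x,y\in X$, $\sim\in\{<,\le,=,\ge,>\}$, $c\in\mathbb{Z}$. $Z_0=\{\mathbf 0+\delta:\delta\ge0\}$. LU-abstraction. Bound functions are $L,U:X\to\mathbb{N}\cup\{-\infty\}$. For valuations, $v\preccurlyeq_{LU} v'$ iff for every clock $x$: if $v'(x)<v(x)$ then $v'(x)>L(x)$, and if $v'(x)>v(x)$ then $v(x)>U(x)$. For a set of valuations $W$, $\mathfrak{a}_{\preccurlyeq LU}(W)=\{v : \exists v'\in W,\ v\preccurlyeq_{LU} v'\}$. For two pairs of bound functions, $L_2U_2\le L_1U_1$ means $L_2(x)\le L_1(x)$ and $U_2(x)\le U_1(x)$ for all $x$. ASG. An adaptive simulation graph for $\mathcal{A}$ is a directed graph whose nodes are labelled $(q,Z,LU)$ with $q\in Q$, $Z$ a zone and $L,U$ bound functions, whose edges are labelled by transitions $t$ of $\mathcal{A}$ such that every edge $(q,Z,LU)\to_t(q',Z',L'U')$ satisfies $(q,Z)\Rightarrow_t(q',Z')$, and in which some nodes are declared tentative, satisfying: (G1) there is a designated initial node $(q_0,Z_0,L_0U_0)$ for some bound functions $L_0U_0$; (G2) if a node $(q,Z,LU)$ is not tentative, then for every transition $(q,Z)\Rightarrow_t(q',Z')$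 the node has a successor along a $t$-labelled edge labelled $(q',Z',L'U')$ for some $L'U'$; (G3) every tentative node $(q,Z,LU)$ is assigned a non-tentative covering node $(q,Z',L'U')$ (same state) with $Z\subseteq\mathfrak{a}_{\preccurlyeq L'U'}(Z')$; (I1) if $(q,Z,LU)$ is a node and a transition $t$ is disabled from $(q,Z)$, then $t$ is disabled from $(q,\mathfrak{a}_{\preccurlyeq LU}(Z))$; (I2) for every edge $(q,Z,LU)\to_t(q',Z',L'U')$, $\mathrm{Post}_t(\mathfrak{a}_{\preccurlyeq LU}(Z))\subseteq\mathfrak{a}_{\preccurlyeq L'U'}(Z')$; (I3) for every tentative node $(q,Z_1,L_1U_1)$ with covering node $(q,Z_2,L_2U_2)$, $L_2U_2\le L_1U_1$.
   Formalization: Added assumption: the covering node of every tentative node reachable from the initial node is itself reachable from it (reachable meaning along edges of G); without it the claim fails, e.g. if a tentative initial node is covered by an unreachable node. *)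

theory Defs
  imports Complex_Main "HOL-Library.FuncSet" "HOL-Library.Option_ord"
begin

section \<open>Valuations, guards and zones\<close>

datatype comparison = Lt | Le | Eq | Ge | Gt

fun compare :: "comparison \<Rightarrow> real \<Rightarrow> real \<Rightarrow> bool" where
  "compare Lt a b \<longleftrightarrow> a < b"
| "compare Le a b \<longleftrightarrow> a \<le> b"
| "compare Eq a b \<longleftrightarrow> a = b"
| "compare Ge a b \<longleftrightarrow> a \<ge> b"
| "compare Gt a b \<longleftrightarrow> a > b"

text \<open>A valuation over \<open>X\<close> is extensional (constantly \<^term>\<open>undefined\<close> outside \<open>X\<close>), so
  that valuations are equal iff they agree on all clocks.\<close>

type_synonym 'x valuation = "'x \<Rightarrow> real"

definition valuations :: "'x set \<Rightarrow> 'x valuation set" where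
  "valuations X = X \<rightarrow>\<^sub>E {0..}"

definition zero_val :: "'x set \<Rightarrow> 'x valuation" where
  "zero_val X = (\<lambda>x\<in>X. 0)"

definition delay :: "'x set \<Rightarrow> 'x valuation \<Rightarrow> real \<Rightarrow> 'x valuation" where
  "delay X v \<delta> = (\<lambda>x\<in>X. v x + \<delta>)"

definition reset :: "'x set \<Rightarrow> 'x set \<Rightarrow> 'x valuation \<Rightarrow> 'x valuation" where
  "reset X R v = (\<lambda>x\<in>X. if x \<in> R then 0 else v x)"

text \<open>A guard is the conjunction of the listed constraints \<open>(x, \<sim>, c)\<close>; the empty list is true.\<close>

type_synonym 'x guard = "('x \<times> comparison \<times> nat) list"

definition guard_over :: "'x set \<Rightarrow> 'x guard \<Rightarrow> bool" where
  "guard_over X g \<longleftrightarrow> (\<forall>(x, cmp, c) \<in> set g. x \<in> X)"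

definition satisfies :: "'x valuation \<Rightarrow> 'x guard \<Rightarrow> bool" where
  "satisfies v g \<longleftrightarrow> (\<forall>(x, cmp, c) \<in> set g. compare cmp (v x) (real c))"

datatype 'x zone_constraint =
    Single 'x comparison int
  | Diagonal 'x 'x comparison int

fun zone_constraint_over :: "'x set \<Rightarrow> 'x zone_constraint \<Rightarrow> bool" where
  "zone_constraint_over X (Single x cmp c) \<longleftrightarrow> x \<in> X"
| "zone_constraint_over X (Diagonal x y cmp c) \<longleftrightarrow> x \<in> X \<and> y \<in> X"

fun satisfies_zone :: "'x valuation \<Rightarrow> 'x zone_constraint \<Rightarrow> bool" where
  "satisfies_zone v (Single x cmp c) \<longleftrightarrow> compare cmp (v x) (real_of_int c)"
| "satisfies_zone v (Diagonal x y cmp c) \<longleftrightarrow> compare cmp (v x - v y) (real_of_int c)"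

definition is_zone :: "'x set \<Rightarrow> 'x valuation set \<Rightarrow> bool" where
  "is_zone X Z \<longleftrightarrow>
     (\<exists>cs. (\<forall>c \<in> set cs. zone_constraint_over X c) \<and>
           Z = {v \<in> valuations X. \<forall>c \<in> set cs. satisfies_zone v c})"

definition initial_zone :: "'x set \<Rightarrow> 'x valuation set" where
  "initial_zone X = {delay X (zero_val X) \<delta> |\<delta>. \<delta> \<ge> 0}"


section \<open>Timed automata and their runs\<close>

datatype ('q, 'x) transition =
  Transition (source: 'q) (guard: "'x guard") (resets: "'x set") (target: 'q)

record ('q, 'x) automaton =
  states :: "'q set"
  initial :: 'q
  clocks :: "'x set"
  transitions :: "('q, 'x) transition set"
  accepting :: "'q set"

definition timed_automaton :: "('q, 'x) automaton \<Rightarrow> bool" where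
  "timed_automaton A \<longleftrightarrow>
     finite (states A) \<and> initial A \<in> states A \<and> accepting A \<subseteq> states A \<and> finite (clocks A) \<and>
     (\<forall>t \<in> transitions A. source t \<in> states A \<and> target t \<in> states A \<and>
        guard_over (clocks A) (guard t) \<and> resets t \<subseteq> clocks A)"

type_synonym ('q, 'x) config = "'q \<times> 'x valuation"

datatype ('q, 'x) label = Delay real | Action "('q, 'x) transition"

inductive move ::
  "('q, 'x) automaton \<Rightarrow> ('q, 'x) config \<Rightarrow> ('q, 'x) label \<Rightarrow> ('q, 'x) config \<Rightarrow> bool"
  for A :: "('q, 'x) automaton" where
  delay_move: "\<delta> \<ge> 0 \<Longrightarrow> move A (q, v) (Delay \<delta>) (q, delay (clocks A) v \<delta>)"
| action_move: "t \<in> transitions A \<Longrightarrow> satisfies v (guard t) \<Longrightarrow>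
    move A (source t, v) (Action t) (target t, reset (clocks A) (resets t) v)"

text \<open>\<open>run A ms c\<close>: the sequence of moves \<open>ms\<close>, latest move last, leads from the initial
  configuration to \<open>c\<close>.\<close>

inductive run :: "('q, 'x) automaton \<Rightarrow> ('q, 'x) label list \<Rightarrow> ('q, 'x) config \<Rightarrow> bool"
  for A :: "('q, 'x) automaton" where
  run_Nil: "run A [] (initial A, zero_val (clocks A))"
| run_snoc: "run A ms c \<Longrightarrow> move A c m c' \<Longrightarrow> run A (ms @ [m]) c'"

definition has_accepting_run :: "('q, 'x) automaton \<Rightarrow> bool" where
  "has_accepting_run A \<longleftrightarrow> (\<exists>ms q v. run A ms (q, v) \<and> q \<in> accepting A)"


section \<open>Symbolic transitions\<close>

definition Post ::
  "('q, 'x) automaton \<Rightarrow> ('q, 'x) transition \<Rightarrow> 'x valuation set \<Rightarrow> 'x valuation set" where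
  "Post A t W =
     {v'. \<exists>v \<in> W. \<exists>\<delta> \<ge> 0. \<exists>u.
        move A (source t, v) (Action t) (target t, u) \<and>
        move A (target t, u) (Delay \<delta>) (target t, v')}"

definition symbolic_step ::
  "('q, 'x) automaton \<Rightarrow> 'q \<times> 'x valuation set \<Rightarrow> ('q, 'x) transition \<Rightarrow>
   'q \<times> 'x valuation set \<Rightarrow> bool" where
  "symbolic_step A s t s' \<longleftrightarrow>
     t \<in> transitions A \<and> fst s = source t \<and> s' = (target t, Post A t (snd s))"

definition disabled ::
  "('q, 'x) automaton \<Rightarrow> ('q, 'x) transition \<Rightarrow> 'x valuation set \<Rightarrow> bool" where
  "disabled A t W \<longleftrightarrow> Post A t W = {}"


section \<open>LU-abstraction\<close>

text \<open>The value \<^term>\<open>None\<close> stands for minus infinity; in the order on options it is the least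
  element.\<close>

type_synonym bound = "nat option"

definition above_bound :: "real \<Rightarrow> bound \<Rightarrow> bool" where
  "above_bound r b \<longleftrightarrow> (case b of None \<Rightarrow> True | Some n \<Rightarrow> r > real n)"

type_synonym 'x lu = "('x \<Rightarrow> bound) \<times> ('x \<Rightarrow> bound)"

definition lu_preorder :: "'x set \<Rightarrow> 'x lu \<Rightarrow> 'x valuation \<Rightarrow> 'x valuation \<Rightarrow> bool" where
  "lu_preorder X LU v v' \<longleftrightarrow>
     (\<forall>x \<in> X. (v' x < v x \<longrightarrow> above_bound (v' x) (fst LU x)) \<and>
              (v' x > v x \<longrightarrow> above_bound (v x) (snd LU x)))"

definition lu_abstraction :: "'x set \<Rightarrow> 'x lu \<Rightarrow> 'x valuation set \<Rightarrow> 'x valuation set" where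
  "lu_abstraction X LU W = {v \<in> valuations X. \<exists>v' \<in> W. lu_preorder X LU v v'}"

definition lu_le :: "'x set \<Rightarrow> 'x lu \<Rightarrow> 'x lu \<Rightarrow> bool" where
  "lu_le X LU\<^sub>2 LU\<^sub>1 \<longleftrightarrow> (\<forall>x \<in> X. fst LU\<^sub>2 x \<le> fst LU\<^sub>1 x \<and> snd LU\<^sub>2 x \<le> snd LU\<^sub>1 x)"


section \<open>Adaptive simulation graphs\<close>

text \<open>Nodes are kept apart from their labels \<open>(q, Z, LU)\<close>: distinct nodes may carry the same
  label.  The function \<open>cover\<close> is relevant on tentative nodes only; the assignment of covering
  nodes is not an edge.\<close>

record ('n, 'q, 'x) graph =
  nodes :: "'n set"
  state_of :: "'n \<Rightarrow> 'q"
  zone_of :: "'n \<Rightarrow> 'x valuation set"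
  lu_of :: "'n \<Rightarrow> 'x lu"
  edges :: "('n \<times> ('q, 'x) transition \<times> 'n) set"
  tentative :: "'n set"
  cover :: "'n \<Rightarrow> 'n"
  root :: 'n

definition labelled_graph :: "('q, 'x) automaton \<Rightarrow> ('n, 'q, 'x) graph \<Rightarrow> bool" where
  "labelled_graph A G \<longleftrightarrow>
     tentative G \<subseteq> nodes G \<and>
     (\<forall>n \<in> nodes G. state_of G n \<in> states A \<and> is_zone (clocks A) (zone_of G n)) \<and>
     (\<forall>(n, t, n') \<in> edges G. n \<in> nodes G \<and> n' \<in> nodes G \<and>
        symbolic_step A (state_of G n, zone_of G n) t (state_of G n', zone_of G n'))"

definition G1 :: "('q, 'x) automaton \<Rightarrow> ('n, 'q, 'x) graph \<Rightarrow> bool" where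
  "G1 A G \<longleftrightarrow>
     root G \<in> nodes G \<and> state_of G (root G) = initial A \<and>
     zone_of G (root G) = initial_zone (clocks A)"

definition G2 :: "('q, 'x) automaton \<Rightarrow> ('n, 'q, 'x) graph \<Rightarrow> bool" where
  "G2 A G \<longleftrightarrow>
     (\<forall>n \<in> nodes G - tentative G. \<forall>t q' Z'.
        symbolic_step A (state_of G n, zone_of G n) t (q', Z') \<longrightarrow>
        (\<exists>n'. (n, t, n') \<in> edges G \<and> state_of G n' = q' \<and> zone_of G n' = Z'))"

definition G3 :: "('q, 'x) automaton \<Rightarrow> ('n, 'q, 'x) graph \<Rightarrow> bool" where
  "G3 A G \<longleftrightarrow>
     (\<forall>n \<in> tentative G.
        cover G n \<in> nodes G - tentative G \<and> state_of G (cover G n) = state_of G n \<and>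
        zone_of G n \<subseteq>
          lu_abstraction (clocks A) (lu_of G (cover G n)) (zone_of G (cover G n)))"

definition I1 :: "('q, 'x) automaton \<Rightarrow> ('n, 'q, 'x) graph \<Rightarrow> bool" where
  "I1 A G \<longleftrightarrow>
     (\<forall>n \<in> nodes G. \<forall>t \<in> transitions A.
        source t = state_of G n \<longrightarrow> disabled A t (zone_of G n) \<longrightarrow>
        disabled A t (lu_abstraction (clocks A) (lu_of G n) (zone_of G n)))"

definition I2 :: "('q, 'x) automaton \<Rightarrow> ('n, 'q, 'x) graph \<Rightarrow> bool" where
  "I2 A G \<longleftrightarrow>
     (\<forall>(n, t, n') \<in> edges G.
        Post A t (lu_abstraction (clocks A) (lu_of G n) (zone_of G n)) \<subseteq>
        lu_abstraction (clocks A) (lu_of G n') (zone_of G n'))"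

definition I3 :: "('q, 'x) automaton \<Rightarrow> ('n, 'q, 'x) graph \<Rightarrow> bool" where
  "I3 A G \<longleftrightarrow>
     (\<forall>n \<in> tentative G. lu_le (clocks A) (lu_of G (cover G n)) (lu_of G n))"

definition adaptive_simulation_graph ::
  "('q, 'x) automaton \<Rightarrow> ('n, 'q, 'x) graph \<Rightarrow> bool" where
  "adaptive_simulation_graph A G \<longleftrightarrow>
     labelled_graph A G \<and> G1 A G \<and> G2 A G \<and> G3 A G \<and> I1 A G \<and> I2 A G \<and> I3 A G"

definition reachable :: "('n, 'q, 'x) graph \<Rightarrow> 'n set" where
  "reachable G = {n. (root G, n) \<in> {(m, m'). \<exists>t. (m, t, m') \<in> edges G}\<^sup>*}"

end

(* Soundness: the zone of a reachable node contains only valuations that some run attains.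
   Completeness: every configuration (q, v) of a run is simulated by a reachable non-tentative
   node with state q whose abstracted zone contains v. Delays preserve this because zones of
   reachable nodes are closed under delay and the LU-preorder is compatible with delay, actions
   preserve it by G2 and I2, and a tentative node is replaced by its covering node, using
   transitivity of the LU-preorder and its antitonicity in the bounds. *)

theory Submission
  imports Defs
begin

lemma delay_in_valuations:
  "v \<in> valuations X \<Longrightarrow> \<delta> \<ge> 0 \<Longrightarrow> delay X v \<delta> \<in> valuations X"
  by (auto simp: valuations_def delay_def PiE_def Pi_def)

lemma delay_delay: "delay X (delay X v a) b = delay X v (a + b)"
  by (auto simp: delay_def)

text \<open>A zero delay is the identity only on extensional functions. \<open>zero_val\<close> and
  \<open>reset\<close> are extensional by construction, so no side condition arises here or in
  \<open>delay_reset\<close>.\<close>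

lemma delay_zero_val: "delay X (zero_val X) 0 = zero_val X"
  by (auto simp: delay_def zero_val_def)

lemma delay_reset: "delay X (reset X R v) 0 = reset X R v"
  by (auto simp: delay_def reset_def)

lemma above_bound_mono: "above_bound r b \<Longrightarrow> r \<le> s \<Longrightarrow> b' \<le> b \<Longrightarrow> above_bound s b'"
  by (auto simp: above_bound_def split: option.splits)

lemma lu_preorder_refl: "lu_preorder X LU v v"
  by (simp add: lu_preorder_def)

text \<open>Adding \<delta> to both valuations keeps the sign of each difference and only raises the
  values that must exceed a bound.\<close>

lemma lu_preorder_delay:
  "lu_preorder X LU v v' \<Longrightarrow> \<delta> \<ge> 0 \<Longrightarrow> lu_preorder X LU (delay X v \<delta>) (delay X v' \<delta>)"
  by (auto simp: lu_preorder_def delay_def elim!: above_bound_mono)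

lemma lu_preorder_antimono:
  "lu_preorder X LU v v' \<Longrightarrow> lu_le X LU' LU \<Longrightarrow> lu_preorder X LU' v v'"
  unfolding lu_preorder_def lu_le_def by (meson above_bound_mono order_refl)

text \<open>If neither step yields the bound directly, \<open>v x\<close> is at most the smaller of
  \<open>u x\<close> and \<open>w x\<close>. The other step then puts \<open>v x\<close> above the
  bound, and with it the smaller value.\<close>

lemma lu_preorder_trans:
  assumes "lu_preorder X LU u v" "lu_preorder X LU v w"
  shows "lu_preorder X LU u w"
  unfolding lu_preorder_def
proof (intro ballI conjI impI)
  fix x assume "x \<in> X"
  with assms have
    below: "v x < u x \<Longrightarrow> above_bound (v x) (fst LU x)"
      "w x < v x \<Longrightarrow> above_bound (w x) (fst LU x)"
    and above: "u x < v x \<Longrightarrow> above_bound (u x) (snd LU x)"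
      "v x < w x \<Longrightarrow> above_bound (v x) (snd LU x)"
    by (auto simp: lu_preorder_def)
  show "above_bound (w x) (fst LU x)" if "w x < u x"
  proof (cases "w x < v x")
    case False
    then show ?thesis using that below(1) by (intro above_bound_mono[of "v x" _ "w x"]) auto
  qed (rule below(2))
  show "above_bound (u x) (snd LU x)" if "u x < w x"
  proof (cases "u x < v x")
    case False
    then show ?thesis using that above(2) by (intro above_bound_mono[of "v x" _ "u x"]) auto
  qed (rule above(1))
qed

lemma subset_lu_abstraction: "W \<subseteq> valuations X \<Longrightarrow> W \<subseteq> lu_abstraction X LU W"
  by (auto simp: lu_abstraction_def intro: lu_preorder_refl)

text \<open>Serves to replace a tentative node by its covering node: I3 weakens the relation for
  \<open>LU\<close> to one for \<open>LU'\<close>, which then composes with the relation given by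
  G3.\<close>

lemma lu_abstraction_cover:
  assumes "Z \<subseteq> lu_abstraction X LU' Z'" "lu_le X LU' LU"
  shows "lu_abstraction X LU Z \<subseteq> lu_abstraction X LU' Z'"
proof
  fix v assume "v \<in> lu_abstraction X LU Z"
  then obtain v' where v: "v \<in> valuations X" "v' \<in> Z" "lu_preorder X LU v v'"
    by (auto simp: lu_abstraction_def)
  from v(2) assms(1) obtain w where "w \<in> Z'" "lu_preorder X LU' v' w"
    by (auto simp: lu_abstraction_def)
  with v assms(2) show "v \<in> lu_abstraction X LU' Z'"
    by (auto simp: lu_abstraction_def intro: lu_preorder_trans lu_preorder_antimono)
qed

text \<open>An edge stands for an action followed by a delay, and no edge stands for a delay alone.
  A delay of a run must therefore stay within the set attached to the current node.\<close>

definition delay_closed :: "'x set \<Rightarrow> 'x valuation set \<Rightarrow> bool" where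
  "delay_closed X W \<longleftrightarrow> (\<forall>v \<in> W. \<forall>\<delta> \<ge> 0. delay X v \<delta> \<in> W)"

lemma delay_closed_lu_abstraction:
  "delay_closed X W \<Longrightarrow> delay_closed X (lu_abstraction X LU W)"
  unfolding delay_closed_def lu_abstraction_def
  by (blast intro: delay_in_valuations lu_preorder_delay)

lemma delay_closed_initial_zone: "delay_closed X (initial_zone X)"
  unfolding delay_closed_def initial_zone_def
  by (auto simp: delay_delay intro!: exI add_nonneg_nonneg)

lemma zero_val_in_initial_zone: "zero_val X \<in> initial_zone X"
  unfolding initial_zone_def using delay_zero_val[of X, symmetric] order_refl by blast

lemma initial_zone_subset: "initial_zone X \<subseteq> valuations X"
  by (auto simp: initial_zone_def zero_val_def delay_def valuations_def)

lemma move_Action_iff: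
  "move A (q, v) (Action t) c \<longleftrightarrow>
     t \<in> transitions A \<and> satisfies v (guard t) \<and> q = source t \<and>
     c = (target t, reset (clocks A) (resets t) v)"
  by (auto simp: move.simps)

lemma move_Delay_iff:
  "move A (q, v) (Delay \<delta>) c \<longleftrightarrow> \<delta> \<ge> 0 \<and> c = (q, delay (clocks A) v \<delta>)"
  by (auto simp: move.simps)

lemma Post_iff:
  "v' \<in> Post A t W \<longleftrightarrow> t \<in> transitions A \<and>
     (\<exists>v \<in> W. \<exists>\<delta> \<ge> 0. satisfies v (guard t) \<and>
        v' = delay (clocks A) (reset (clocks A) (resets t) v) \<delta>)"
  by (auto simp: Post_def move_Action_iff move_Delay_iff)

text \<open>Each element of a Post set ends with a delay \<delta>, which absorbs a further
  \<epsilon> as \<delta> + \<epsilon>.\<close>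

lemma delay_closed_Post: "delay_closed (clocks A) (Post A t W)"
proof -
  have "delay (clocks A) v' \<epsilon> \<in> Post A t W" if v': "v' \<in> Post A t W" and "\<epsilon> \<ge> 0" for v' \<epsilon>
  proof -
    from v' obtain v \<delta> where v: "t \<in> transitions A" "v \<in> W" "\<delta> \<ge> 0" "satisfies v (guard t)"
      "v' = delay (clocks A) (reset (clocks A) (resets t) v) \<delta>"
      unfolding Post_iff by blast
    with \<open>\<epsilon> \<ge> 0\<close> show ?thesis
      unfolding Post_iff by (auto simp: delay_delay intro!: bexI[of _ v] exI[of _ "\<delta> + \<epsilon>"])
  qed
  then show ?thesis by (simp add: delay_closed_def)
qed

text \<open>Links an action of a run, which lets no time pass, to \<open>Post\<close>: the final
  delay is taken to be 0.\<close>

lemma reset_in_Post: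
  assumes "v \<in> W" "t \<in> transitions A" "satisfies v (guard t)"
  shows "reset (clocks A) (resets t) v \<in> Post A t W"
  unfolding Post_iff using assms delay_reset[symmetric] order_refl by blast

lemma reachable_induct [consumes 1, case_names root edge]:
  assumes "n \<in> reachable G"
    and "P (root G)"
    and "\<And>m t n. m \<in> reachable G \<Longrightarrow> (m, t, n) \<in> edges G \<Longrightarrow> P m \<Longrightarrow> P n"
  shows "P n"
proof -
  have "(root G, n) \<in> {(m, m'). \<exists>t. (m, t, m') \<in> edges G}\<^sup>*"
    using assms(1) by (simp add: reachable_def)
  then show ?thesis
    by (induction rule: rtrancl_induct) (use assms(2,3) in \<open>auto simp: reachable_def\<close>)
qed

lemma root_reachable: "root G \<in> reachable G"
  by (simp add: reachable_def)

lemma edge_reachable: "m \<in> reachable G \<Longrightarrow> (m, t, n) \<in> edges G \<Longrightarrow> n \<in> reachable G"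
  by (auto simp: reachable_def intro: rtrancl_into_rtrancl)

lemma edge_labels:
  assumes "labelled_graph A G" "(m, t, n) \<in> edges G"
  shows "n \<in> nodes G" "state_of G m = source t" "state_of G n = target t"
    "zone_of G n = Post A t (zone_of G m)"
  using assms by (auto simp: labelled_graph_def symbolic_step_def)

lemma reachable_in_nodes:
  "labelled_graph A G \<Longrightarrow> G1 A G \<Longrightarrow> n \<in> reachable G \<Longrightarrow> n \<in> nodes G"
  by (erule reachable_induct) (auto simp: G1_def dest: edge_labels)

text \<open>A zone alone need not be closed under delay, as x = 0 shows. Reachable nodes carry the
  initial zone or a Post set.\<close>

lemma delay_closed_zone_of:
  assumes "labelled_graph A G" "G1 A G" "n \<in> reachable G"
  shows "delay_closed (clocks A) (zone_of G n)"
  using assms(3)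
proof (induction rule: reachable_induct)
  case root
  then show ?case using assms(2) by (simp add: G1_def delay_closed_initial_zone)
next
  case edge
  then show ?case using edge_labels[OF assms(1)] by (simp add: delay_closed_Post)
qed

text \<open>Edges carry exact Post sets of zones, not of their abstractions, so each valuation
  traces back to one in the predecessor. The induction generalises over \<open>v\<close> for this
  reason.\<close>

lemma graph_sound:
  assumes "labelled_graph A G" "G1 A G" "n \<in> reachable G" "v \<in> zone_of G n"
  shows "\<exists>ms. run A ms (state_of G n, v)"
  using assms(3,4)
proof (induction arbitrary: v rule: reachable_induct)
  case root
  then obtain \<delta> where "\<delta> \<ge> 0" "v = delay (clocks A) (zero_val (clocks A)) \<delta>"
    using assms(2) by (auto simp: G1_def initial_zone_def)
  moreover have "state_of G (root G) = initial A"
    using assms(2) by (simp add: G1_def)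
  ultimately show ?case
    using run_snoc[OF run_Nil delay_move] by metis
next
  case (edge m t n)
  note n = edge_labels[OF assms(1) edge.hyps(2)]
  from edge.prems obtain u \<delta> where u: "t \<in> transitions A" "u \<in> zone_of G m" "\<delta> \<ge> 0"
    "satisfies u (guard t)" "v = delay (clocks A) (reset (clocks A) (resets t) u) \<delta>"
    unfolding n(4) Post_iff by blast
  from edge.IH[OF u(2)] obtain ms where "run A ms (source t, u)"
    using n(2) by auto
  from run_snoc[OF run_snoc[OF this action_move[OF u(1,4)]] delay_move[OF u(3)]]
  show ?case using n(3) u(5) by auto
qed

text \<open>Membership is in the abstracted zone because G3 places the zone of a tentative node only
  inside the abstraction at its covering node.\<close>

definition simulates ::
  "('q, 'x) automaton \<Rightarrow> ('n, 'q, 'x) graph \<Rightarrow> 'n \<Rightarrow> ('q, 'x) config \<Rightarrow> bool" where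
  "simulates A G n c \<longleftrightarrow> n \<in> reachable G \<and> state_of G n = fst c \<and>
     snd c \<in> lu_abstraction (clocks A) (lu_of G n) (zone_of G n)"

text \<open>One replacement suffices, since G3 makes covering nodes non-tentative.\<close>

lemma simulates_non_tentative:
  assumes "G3 A G" "I3 A G"
    and "\<forall>n \<in> tentative G. n \<in> reachable G \<longrightarrow> cover G n \<in> reachable G"
    and "simulates A G n c"
  shows "\<exists>n'. n' \<notin> tentative G \<and> simulates A G n' c"
proof (cases "n \<in> tentative G")
  case True
  then have "lu_abstraction (clocks A) (lu_of G n) (zone_of G n)
      \<subseteq> lu_abstraction (clocks A) (lu_of G (cover G n)) (zone_of G (cover G n))"
    using assms(1,2) by (intro lu_abstraction_cover) (auto simp: G3_def I3_def)
  with True assms have "cover G n \<notin> tentative G" "simulates A G (cover G n) c"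
    by (auto simp: simulates_def G3_def)
  then show ?thesis by blast
qed (use assms in blast)

text \<open>Keeping the simulating node non-tentative makes G2 available at the next action.\<close>

lemma graph_complete:
  assumes "labelled_graph A G" "G1 A G" "G2 A G" "G3 A G" "I2 A G" "I3 A G"
    and cover: "\<forall>n \<in> tentative G. n \<in> reachable G \<longrightarrow> cover G n \<in> reachable G"
    and "run A ms c"
  shows "\<exists>n. n \<notin> tentative G \<and> simulates A G n c"
  using assms(8)
proof (induction rule: run.induct)
  case run_Nil
  have "simulates A G (root G) (initial A, zero_val (clocks A))"
    using assms(2) subset_lu_abstraction[OF initial_zone_subset] zero_val_in_initial_zone
    by (fastforce simp: simulates_def G1_def root_reachable)
  then show ?case by (rule simulates_non_tentative[OF assms(4,6) cover])
next
  case (run_snoc ms c m c')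
  then obtain n where n: "n \<notin> tentative G" "simulates A G n c" by blast
  from run_snoc.hyps(2) show ?case
  proof cases
    case (delay_move \<delta> q v)
    have "delay_closed (clocks A) (lu_abstraction (clocks A) (lu_of G n) (zone_of G n))"
      using n(2) assms(1,2)
      by (simp add: simulates_def delay_closed_lu_abstraction delay_closed_zone_of)
    with n delay_move show ?thesis
      by (auto simp: simulates_def delay_closed_def)
  next
    case (action_move t v)
    have "n \<in> nodes G - tentative G"
      using n reachable_in_nodes[OF assms(1,2)] by (simp add: simulates_def)
    \<comment> \<open>Only the abstracted zone is known to contain \<open>v\<close>.
      \<open>symbolic_step\<close> asks for a transition of \<open>A\<close> leaving the state of
      \<open>n\<close>, whether or not the Post set is empty, so G2 applies.\<close>
    moreover have "symbolic_step A (state_of G n, zone_of G n) t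
        (target t, Post A t (zone_of G n))"
      using n(2) action_move by (simp add: symbolic_step_def simulates_def)
    ultimately obtain n' where n': "(n, t, n') \<in> edges G" "state_of G n' = target t"
      using assms(3) unfolding G2_def by blast
    have "reset (clocks A) (resets t) v
        \<in> Post A t (lu_abstraction (clocks A) (lu_of G n) (zone_of G n))"
      using n(2) action_move by (intro reset_in_Post) (auto simp: simulates_def)
    also have "\<dots> \<subseteq> lu_abstraction (clocks A) (lu_of G n') (zone_of G n')"
      using assms(5) n'(1) by (auto simp: I2_def)
    finally have "simulates A G n' c'"
      using n' n(2) action_move edge_reachable[of n G t n'] by (simp add: simulates_def)
    then show ?thesis by (rule simulates_non_tentative[OF assms(4,6) cover])
  qed
qed

text \<open>Reachability follows edges only, and the graph conditions do not tie
  \<open>cover\<close> to it: a tentative root without edges may be covered by an unreachable copy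
  of itself from which alone accepting nodes are reached. \<open>cover_reachable\<close>, a
  hypothesis added to the English statement, excludes this.\<close>

theorem theorem1:
  fixes A :: "('q, 'x) automaton" and G :: "('n, 'q, 'x) graph"
  assumes "timed_automaton A"
    and "adaptive_simulation_graph A G"
    and cover_reachable: "\<forall>n \<in> tentative G. n \<in> reachable G \<longrightarrow> cover G n \<in> reachable G"
  shows "has_accepting_run A \<longleftrightarrow>
    (\<exists>n \<in> nodes G. n \<in> reachable G \<and> state_of G n \<in> accepting A \<and> zone_of G n \<noteq> {})"
proof
  have G: "labelled_graph A G" "G1 A G" "G2 A G" "G3 A G" "I2 A G" "I3 A G"
    using assms(2) by (auto simp: adaptive_simulation_graph_def)
  show "has_accepting_run A" if "\<exists>n \<in> nodes G. n \<in> reachable G \<and> state_of G n \<in> accepting A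
      \<and> zone_of G n \<noteq> {}"
    using that graph_sound[OF G(1,2)] unfolding has_accepting_run_def by blast
  assume "has_accepting_run A"
  then obtain ms q v where "run A ms (q, v)" and q: "q \<in> accepting A"
    by (auto simp: has_accepting_run_def)
  then obtain n where "simulates A G n (q, v)"
    using graph_complete[OF G cover_reachable] by blast
  \<comment> \<open>The abstraction of the empty set is empty, so a simulating node has a non-empty
    zone.\<close>
  with q show "\<exists>n \<in> nodes G. n \<in> reachable G \<and> state_of G n \<in> accepting A \<and> zone_of G n \<noteq> {}"
    using reachable_in_nodes[OF G(1,2)] by (auto simp: simulates_def lu_abstraction_def)
qed

end
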